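(* Let $G=(V,E)$ be an undirected decomposable graph on $V=\{1,\dots,m\}$, with vertices ordered so that $V\in S_D$. Let $U$ be an $m\times m$ (symmetric) positive definite matrix and let $\alpha=(\alpha_1,\dots,\alpha_m)\in\mathbb{R}^m$ have nonnegative entries. If $$\alpha_i>|\mathcal{N}^{\prec}(i)|+2\qquad\text{for all } i=1,\dots,m,$$ then $$\int_{\Theta_G}\exp\Big(-\tfrac12\Big\{\operatorname{tr}\big((LDL^T)^{-1}U\big)+\sum_{i=1}^m\alpha_i\log D_{ii}\Big\}\Big)\,dL\,dD<\infty .$$
   Context: Edges are undirected: $(i,j)\in E$ iff $(j,i)\in E$, with no loops. $G$ is decomposable if it has no induced cycle of length at least four. $P_G$ is the set of $m\times m$ symmetric positive definite matrices $\Sigma$ with $\Sigma_{ij}=0$ whenever $i\ne j$ and $(i,j)\notin E$. $\mathcal{L}_G$ is the set of $m\times m$ lower-triangular matrices $L$ with $L_{ii}=1$ for all $i$ and $L_{ij}=0$ for $i>j$, $(i,j)\notin E$. $\Theta_G=\{(L,D): L\in\mathcal{L}_G,\ D \text{ diagonal with } D_{ii}>0 \text{ for all } i\}$. Every positive definite $\Sigma$ has a unique modified Cholesky decomposition $\Sigma=LDL^T$ with $L$ lower-triangular with unit diagonal and $D$ diagonal with positive diagonal entries. The ordering condition $V\in S_D$ means: for every positive definite $\Sigma$ with modified Cholesky decomposition $\Sigma=LDL^T$, one has $L\in\mathcal{L}_G\Leftrightarrow\Sigma\in P_G$. $\mathcal{N}^{\prec}(i)=\{j:(i,j)\in E,\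 j<i\}$. The integration measure is $dL=\prod_{(i,j)\in E,\,i>j}dL_{ij}$, $dD=\prod_{i=1}^m dD_{ii}$ (Lebesgue measure on the free entries). *)

theory Defs
  imports
    "HOL-Analysis.Analysis"
    "Jordan_Normal_Form.Gauss_Jordan_Elimination"
begin

unbundle no inner_syntax
unbundle no vec_syntax

text \<open>
  Matrices and graphs are indexed from \<open>0\<close>: the vertex set \<open>{1, \<dots>, m}\<close> with its usual order is
  rendered as \<open>{..<m}\<close>, matching the index ranges of the matrix library. An undirected edge is
  represented by both of its ordered pairs.
\<close>

definition undirected_graph :: "nat \<Rightarrow> (nat \<times> nat) set \<Rightarrow> bool" where
  "undirected_graph m E \<longleftrightarrow> E \<subseteq> {..<m} \<times> {..<m} \<and> sym E \<and> irrefl E"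

definition induced_cycle :: "nat \<Rightarrow> (nat \<times> nat) set \<Rightarrow> nat list \<Rightarrow> bool" where
  "induced_cycle m E c \<longleftrightarrow>
     3 \<le> length c \<and> distinct c \<and> set c \<subseteq> {..<m} \<and>
     (\<forall>a<length c. \<forall>b<length c.
        (c ! a, c ! b) \<in> E \<longleftrightarrow> b = Suc a mod length c \<or> a = Suc b mod length c)"

definition decomposable :: "nat \<Rightarrow> (nat \<times> nat) set \<Rightarrow> bool" where
  "decomposable m E \<longleftrightarrow> \<not> (\<exists>c. induced_cycle m E c \<and> 4 \<le> length c)"

definition pos_def :: "nat \<Rightarrow> real mat set" where
  "pos_def m = {A \<in> carrier_mat m m. A\<^sup>T = A \<and>
     (\<forall>v \<in> carrier_vec m. v \<noteq> 0\<^sub>v m \<longrightarrow> 0 < v \<bullet> (A *\<^sub>v v))}"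

definition P_G :: "nat \<Rightarrow> (nat \<times> nat) set \<Rightarrow> real mat set" where
  "P_G m E = {S \<in> pos_def m. \<forall>i<m. \<forall>j<m. i \<noteq> j \<and> (i, j) \<notin> E \<longrightarrow> S $$ (i, j) = 0}"

definition unit_lower_triangular :: "nat \<Rightarrow> real mat set" where
  "unit_lower_triangular m = {L \<in> carrier_mat m m.
     (\<forall>i<m. L $$ (i, i) = 1) \<and> (\<forall>i<m. \<forall>j<m. i < j \<longrightarrow> L $$ (i, j) = 0)}"

definition L_G :: "nat \<Rightarrow> (nat \<times> nat) set \<Rightarrow> real mat set" where
  "L_G m E = {L \<in> unit_lower_triangular m.
     \<forall>i<m. \<forall>j<i. (i, j) \<notin> E \<longrightarrow> L $$ (i, j) = 0}"

definition pos_diagonal :: "nat \<Rightarrow> real mat set" where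
  "pos_diagonal m = {D \<in> carrier_mat m m. diagonal_mat D \<and> (\<forall>i<m. 0 < D $$ (i, i))}"

definition Theta_G :: "nat \<Rightarrow> (nat \<times> nat) set \<Rightarrow> (real mat \<times> real mat) set" where
  "Theta_G m E = L_G m E \<times> pos_diagonal m"

text \<open>The condition that the given order of the vertices belongs to \<open>S\<^sub>D\<close>.\<close>

definition order_in_S_D :: "nat \<Rightarrow> (nat \<times> nat) set \<Rightarrow> bool" where
  "order_in_S_D m E \<longleftrightarrow>
     (\<forall>S \<in> pos_def m. \<forall>L \<in> unit_lower_triangular m. \<forall>D \<in> pos_diagonal m.
        S = L * D * L\<^sup>T \<longrightarrow> (L \<in> L_G m E \<longleftrightarrow> S \<in> P_G m E))"

definition pred_nbrs :: "(nat \<times> nat) set \<Rightarrow> nat \<Rightarrow> nat set" where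
  "pred_nbrs E i = {j. (i, j) \<in> E \<and> j < i}"

definition mat_trace :: "real mat \<Rightarrow> real" where
  "mat_trace A = (\<Sum>i<dim_row A. A $$ (i, i))"

text \<open>Only meaningful for invertible \<open>A\<close>, where \<open>mat_inverse\<close> does not return \<open>None\<close>.\<close>

definition inv_mat :: "real mat \<Rightarrow> real mat" where
  "inv_mat A = the (mat_inverse A)"

text \<open>
  The integral over \<open>\<Theta>\<^sub>G\<close> with respect to \<open>dL dD\<close>: Lebesgue measure on the free entries
  \<open>x (i, j)\<close>, \<open>(i, j) \<in> E\<close>, \<open>j < i\<close>, of \<open>L\<close> and on the diagonal entries \<open>d i\<close> of \<open>D\<close>. The
  indicator restricts the latter to positive values.
\<close>

definition free_entries :: "(nat \<times> nat) set \<Rightarrow> (nat \<times> nat) set" where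
  "free_entries E = {(i, j) \<in> E. j < i}"

definition mat_L :: "nat \<Rightarrow> (nat \<times> nat) set \<Rightarrow> (nat \<times> nat \<Rightarrow> real) \<Rightarrow> real mat" where
  "mat_L m E x = mat m m (\<lambda>(i, j).
     if i = j then 1 else if (i, j) \<in> free_entries E then x (i, j) else 0)"

definition nn_integral_Theta_G ::
    "nat \<Rightarrow> (nat \<times> nat) set \<Rightarrow> (real mat \<Rightarrow> real mat \<Rightarrow> ennreal) \<Rightarrow> ennreal" where
  "nn_integral_Theta_G m E f =
     (\<integral>\<^sup>+ (x, d). f (mat_L m E x) (mat_diag m d) *
           indicator (Theta_G m E) (mat_L m E x, mat_diag m d)
        \<partial>(Pi\<^sub>M (free_entries E) (\<lambda>_. lborel) \<Otimes>\<^sub>M Pi\<^sub>M {..<m} (\<lambda>_. lborel)))"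

end

theory Submission
  imports Defs "HOL-Probability.Probability" "Jordan_Normal_Form.Determinant"
begin

unbundle no inner_syntax

text \<open>
  With \<open>N = L\<^sup>-\<^sup>1\<close> the trace is \<open>\<Sum>\<^sub>i q(N\<^sub>i) / D\<^sub>i\<^sub>i\<close>, where \<open>N\<^sub>i\<close> is the \<open>i\<close>-th row of \<open>N\<close> and \<open>q\<close> the
  quadratic form of \<open>U\<close>. By compactness \<open>q(v) \<ge> c |v|\<^sup>2\<close> for some \<open>c > 0\<close>, and in \<open>|N\<^sub>i|\<^sup>2\<close> it is
  enough to keep the diagonal entry \<open>1\<close> and the entries \<open>N\<^sub>i\<^sub>k\<close> at the free positions. There
  \<open>N\<^sub>i\<^sub>k = - (L\<^sub>i\<^sub>k + g\<^sub>i\<^sub>k)\<close>, where \<open>g\<^sub>i\<^sub>k\<close> depends only on rows above \<open>i\<close> and on entries of row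
  \<open>i\<close> to the right of \<open>k\<close>, so a triangular substitution of Jacobian \<open>1\<close> turns the integral over
  \<open>L\<close> into a product of centred Gaussian integrals. With \<open>n\<^sub>i\<close> the number of earlier neighbours of
  \<open>i\<close>, what remains is a product of integrals of \<open>t\<close> to the power \<open>- (\<alpha>\<^sub>i - n\<^sub>i) / 2\<close> times
  \<open>exp (- c / (2 t))\<close> over \<open>t > 0\<close>, which converge because \<open>(\<alpha>\<^sub>i - n\<^sub>i) / 2 > 1\<close>.
\<close>

section \<open>Triangular substitutions for products of Lebesgue measure\<close>

lemma nn_integral_shift_lborel:
  fixes f :: "real \<Rightarrow> ennreal"
  assumes [measurable]: "f \<in> borel_measurable borel"
  shows "(\<integral>\<^sup>+ t. f (t + c) \<partial>lborel) = (\<integral>\<^sup>+ t. f t \<partial>lborel)"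
  using nn_integral_real_affine[of f 1 c] by (simp add: add.commute)

interpretation lborel_product: product_sigma_finite "\<lambda>_. lborel :: real measure"
  by standard

text \<open>Integrate the coordinate \<open>a\<close> of largest rank first. No shift depends on it,
  since \<open>g e\<close> reads only coordinates of rank below \<open>r e\<close>; so
  \<open>y\<close> occurs only in the factor of \<open>a\<close>, where translation invariance
  removes \<open>g a x\<close>. That integral is a constant factor, and induction on the number of
  coordinates treats the others.\<close>

lemma nn_integral_triangular_shift:
  fixes f :: "'a \<Rightarrow> real \<Rightarrow> ennreal" and r :: "'a \<Rightarrow> nat"
    and g :: "'a \<Rightarrow> ('a \<Rightarrow> real) \<Rightarrow> real"
  assumes "finite I" "inj_on r I"
    and "\<And>e. e \<in> I \<Longrightarrow> g e \<in> borel_measurable (Pi\<^sub>M I (\<lambda>_. lborel))"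
    and "\<And>e x y. e \<in> I \<Longrightarrow> (\<And>e'. e' \<in> I \<Longrightarrow> r e' < r e \<Longrightarrow> x e' = y e') \<Longrightarrow> g e x = g e y"
    and "\<And>e. e \<in> I \<Longrightarrow> f e \<in> borel_measurable borel"
  shows "(\<integral>\<^sup>+ x. (\<Prod>e\<in>I. f e (x e + g e x)) \<partial>Pi\<^sub>M I (\<lambda>_. lborel)) = (\<Prod>e\<in>I. \<integral>\<^sup>+ t. f e t \<partial>lborel)"
  using assms
proof (induction "card I" arbitrary: I)
  case 0
  have "I = {}" using 0(1,2) by simp
  then show ?case by (simp add: lborel_product.nn_integral_empty del: nn_integral_const)
next
  case (Suc n)
  have fin: "finite I" by fact
  have "I \<noteq> {}" using Suc.hyps(2) by auto
  then have "Max (r ` I) \<in> r ` I" using fin by (intro Max_in) auto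
  then obtain a where a: "a \<in> I" "r a = Max (r ` I)" by force
  define J where "J = I - {a}"
  have I: "I = insert a J" "a \<notin> J" and [simp]: "finite J" using a fin by (auto simp: J_def)
  have less: "r e < r a" if "e \<in> J" for e
  proof -
    have "r e \<le> r a" using that fin a by (simp add: J_def)
    moreover have "r e \<noteq> r a" using that Suc.prems(2) a unfolding J_def inj_on_def by auto
    ultimately show ?thesis by simp
  qed
  have gupd: "g e (x(a := y)) = g e x" if "e \<in> I" for e x y
  proof (rule Suc.prems(4)[OF that])
    fix e' assume "e' \<in> I" "r e' < r e"
    moreover have "r e \<le> r a" using that fin a by simp
    ultimately show "(x(a := y)) e' = x e'" by auto
  qed
  have gI [measurable]: "g e \<in> borel_measurable (Pi\<^sub>M (insert a J) (\<lambda>_. lborel))" if "e \<in> I" for e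
    using Suc.prems(3)[OF that] I by simp
  have fI [measurable]: "f e \<in> borel_measurable borel" if "e \<in> I" for e
    using Suc.prems(5)[OF that] .
  \<comment> \<open>The shift is known to be measurable on the larger product only. Fixing
    coordinate \<open>a\<close> at 0 leaves its value unchanged by \<open>gupd\<close> and carries
    measurability over to the product over \<open>J\<close>.\<close>
  have gJ [measurable]: "g e \<in> borel_measurable (Pi\<^sub>M J (\<lambda>_. lborel))" if "e \<in> I" for e
  proof -
    have "(\<lambda>x. g e (x(a := 0))) \<in> borel_measurable (Pi\<^sub>M J (\<lambda>_. lborel))"
      by (rule measurable_compose[OF _ gI[OF that]]) simp
    then show ?thesis by (simp add: gupd[OF that])
  qed
  have aI [simp]: "a \<in> I" by fact
  have JI [simp]: "e \<in> J \<Longrightarrow> e \<in> I" for e by (simp add: I)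
  have meas_J [measurable]: "(\<lambda>x. \<Prod>e\<in>J. f e (x e + g e x)) \<in> borel_measurable (Pi\<^sub>M J (\<lambda>_. lborel))"
  proof (rule borel_measurable_prod_ennreal)
    fix e assume e: "e \<in> J"
    have "(\<lambda>x. x e + g e x) \<in> borel_measurable (Pi\<^sub>M J (\<lambda>_. lborel))"
      using gJ[OF JI[OF e]] e by measurable
    from measurable_compose[OF this fI[of e]] e
    show "(\<lambda>x. f e (x e + g e x)) \<in> borel_measurable (Pi\<^sub>M J (\<lambda>_. lborel))" by simp
  qed
  have meas_I: "(\<lambda>x. \<Prod>e\<in>I. f e (x e + g e x)) \<in> borel_measurable (Pi\<^sub>M (insert a J) (\<lambda>_. lborel))"
  proof (rule borel_measurable_prod_ennreal)
    fix e assume e: "e \<in> I"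
    then have "(\<lambda>x. x e + g e x) \<in> borel_measurable (Pi\<^sub>M (insert a J) (\<lambda>_. lborel))"
      using gI[of e] e unfolding I(1) by measurable
    from measurable_compose[OF this fI[of e]] e
    show "(\<lambda>x. f e (x e + g e x)) \<in> borel_measurable (Pi\<^sub>M (insert a J) (\<lambda>_. lborel))" by simp
  qed
  have "(\<integral>\<^sup>+ x. (\<Prod>e\<in>I. f e (x e + g e x)) \<partial>Pi\<^sub>M I (\<lambda>_. lborel)) =
    (\<integral>\<^sup>+ x. (\<integral>\<^sup>+ y. (\<Prod>e\<in>I. f e ((x(a := y)) e + g e (x(a := y)))) \<partial>lborel) \<partial>Pi\<^sub>M J (\<lambda>_. lborel))"
    by (rule lborel_product.product_nn_integral_insert[OF \<open>finite J\<close> \<open>a \<notin> J\<close> meas_I, folded I(1)])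
  also have "\<dots> = (\<integral>\<^sup>+ x. (\<integral>\<^sup>+ y. f a (y + g a x) * (\<Prod>e\<in>J. f e (x e + g e x)) \<partial>lborel) \<partial>Pi\<^sub>M J (\<lambda>_. lborel))"
  proof (intro nn_integral_cong)
    fix x y
    have "(\<Prod>e\<in>I. f e ((x(a := y)) e + g e (x(a := y)))) = (\<Prod>e\<in>I. f e ((x(a := y)) e + g e x))"
      by (rule prod.cong) (simp_all only: gupd)
    also have "\<dots> = f a (y + g a x) * (\<Prod>e\<in>J. f e ((x(a := y)) e + g e x))"
      unfolding I(1) using I(2) by simp
    also have "(\<Prod>e\<in>J. f e ((x(a := y)) e + g e x)) = (\<Prod>e\<in>J. f e (x e + g e x))"
      using I(2) by (intro prod.cong) auto
    finally show "(\<Prod>e\<in>I. f e ((x(a := y)) e + g e (x(a := y)))) = f a (y + g a x) * (\<Prod>e\<in>J. f e (x e + g e x))" .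
  qed
  \<comment> \<open>For fixed \<open>x\<close> the shift \<open>g a x\<close> is a constant, so the
    inner integral no longer depends on \<open>x\<close>.\<close>
  also have "\<dots> = (\<integral>\<^sup>+ x. (\<integral>\<^sup>+ y. f a y \<partial>lborel) * (\<Prod>e\<in>J. f e (x e + g e x)) \<partial>Pi\<^sub>M J (\<lambda>_. lborel))"
    using fI[OF aI] by (simp add: nn_integral_multc nn_integral_shift_lborel)
  also have "\<dots> = (\<integral>\<^sup>+ y. f a y \<partial>lborel) * (\<integral>\<^sup>+ x. (\<Prod>e\<in>J. f e (x e + g e x)) \<partial>Pi\<^sub>M J (\<lambda>_. lborel))"
    by (rule nn_integral_cmult) (rule meas_J)
  also have "(\<integral>\<^sup>+ x. (\<Prod>e\<in>J. f e (x e + g e x)) \<partial>Pi\<^sub>M J (\<lambda>_. lborel)) = (\<Prod>e\<in>J. \<integral>\<^sup>+ t. f e t \<partial>lborel)"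
  proof (rule Suc.hyps)
    show "n = card J" using Suc.hyps(2) I by simp
    show "inj_on r J" using Suc.prems(2) I by (simp add: inj_on_def)
    show "g e x = g e y" if "e \<in> J" "\<And>e'. e' \<in> J \<Longrightarrow> r e' < r e \<Longrightarrow> x e' = y e'" for e x y
      using Suc.prems(4)[of e x y] that less[OF that(1)] I by force
  qed (auto intro: gJ fI)
  also have "(\<integral>\<^sup>+ y. f a y \<partial>lborel) * (\<Prod>e\<in>J. \<integral>\<^sup>+ t. f e t \<partial>lborel) = (\<Prod>e\<in>I. \<integral>\<^sup>+ t. f e t \<partial>lborel)"
    using I by simp
  finally show ?case .
qed

section \<open>Two integrals on the line: Gaussian and inverse gamma\<close>

text \<open>The integrand is a multiple of the centred normal density of variance 1 / (2c), whose
  total mass is 1.\<close>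

lemma nn_integral_gaussian:
  assumes "0 < c"
  shows "(\<integral>\<^sup>+ x. ennreal (exp (- c * x\<^sup>2)) \<partial>lborel) = ennreal (sqrt (pi / c))"
proof -
  define s where "s = sqrt (1 / (2 * c))"
  have s: "0 < s" "s\<^sup>2 = 1 / (2 * c)" using assms by (simp_all add: s_def)
  have *: "exp (- c * x\<^sup>2) = sqrt (pi / c) * normal_density 0 s x" for x
    using assms by (simp add: normal_density_def s field_simps real_sqrt_divide)
  have "(\<integral>\<^sup>+ x. ennreal (exp (- c * x\<^sup>2)) \<partial>lborel)
      = (\<integral>\<^sup>+ x. ennreal (sqrt (pi / c)) * ennreal (normal_density 0 s x) \<partial>lborel)"
    using assms by (simp only: *) (simp add: ennreal_mult)
  also have "\<dots> = ennreal (sqrt (pi / c)) * (\<integral>\<^sup>+ x. ennreal (normal_density 0 s x) \<partial>lborel)"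
    by (rule nn_integral_cmult) simp
  also have "(\<integral>\<^sup>+ x. ennreal (normal_density 0 s x) \<partial>lborel) = 1"
    using s(1) by (subst nn_integral_eq_integral) (auto simp: integrable_normal_density)
  finally show ?thesis by simp
qed

text \<open>Near 0 the factor \<open>exp (- (c / t))\<close> decays faster than any power of
  \<open>t\<close> and keeps the integrand bounded. From 1 on it is at most 1, and
  \<open>t powr (- a)\<close> is integrable there because \<open>a > 1\<close>.\<close>

lemma nn_integral_powr_exp_inverse_finite:
  fixes a c :: real
  assumes "1 < a" "0 < c"
  shows "(\<integral>\<^sup>+ t. ennreal (t powr (- a) * exp (- (c / t))) * indicator {0<..} t \<partial>lborel) < \<infinity>"
proof -
  obtain N :: nat where N: "a \<le> real N" using real_arch_simple by blast
  \<comment> \<open>For \<open>t \<le> 1\<close> one has \<open>t powr a \<ge> t ^ N\<close>, and a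
    single term of the exponential series gives
    \<open>exp (c / t) \<ge> (c / t) ^ N / fact N\<close>. In the product of the two lower bounds
    \<open>t\<close> cancels; \<open>K\<close> is its reciprocal.\<close>
  define K where "K = fact N / c ^ N"
  have bnd: "t powr (- a) * exp (- (c / t)) \<le> K" if t: "0 < t" "t \<le> 1" for t
  proof -
    have "t powr (- a) * exp (- (c / t)) = inverse (t powr a * exp (c / t))"
      by (simp add: powr_minus exp_minus)
    also have "(c / t) ^ N / fact N \<le> exp (c / t)"
    proof -
      have "(\<Sum>n\<in>{N}. (c / t) ^ n /\<^sub>R fact n) \<le> (\<Sum>n. (c / t) ^ n /\<^sub>R fact n)"
        using assms t by (intro sum_le_suminf summable_exp_generic) auto
      then show ?thesis by (simp add: exp_def divide_inverse mult.commute)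
    qed
    then have "t ^ N * ((c / t) ^ N / fact N) \<le> t powr a * exp (c / t)"
    proof (intro mult_mono)
      have "t ^ N = t powr real N" using t by (simp add: powr_realpow)
      also have "\<dots> \<le> t powr a" using powr_mono'[OF N] t by simp
      finally show "t ^ N \<le> t powr a" .
    qed (use assms t in auto)
    then have "inverse (t powr a * exp (c / t)) \<le> inverse (t ^ N * ((c / t) ^ N / fact N))"
      using assms t by (intro le_imp_inverse_le) auto
    also have "\<dots> = K" using t by (simp add: K_def power_divide)
    finally show ?thesis .
  qed
  have int: "(\<integral>\<^sup>+ t. ennreal (t powr (- a)) * indicator {1..} t \<partial>lborel)
      = ennreal (- (1 powr (- a + 1)) / (- a + 1))"
    using has_integral_powr_to_inf[of "- a" 1] assms
    by (intro nn_integral_has_integral_lebesgue') auto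
  have "(\<integral>\<^sup>+ t. ennreal (t powr (- a) * exp (- (c / t))) * indicator {0<..} t \<partial>lborel)
    \<le> (\<integral>\<^sup>+ t. ennreal K * indicator {0..1} t + ennreal (t powr (- a)) * indicator {1..} t \<partial>lborel)"
  proof (intro nn_integral_mono)
    fix t :: real
    have "t powr (- a) * exp (- (c / t)) \<le> t powr (- a)" if "1 < t"
      using assms that by (intro mult_left_le) auto
    then show "ennreal (t powr (- a) * exp (- (c / t))) * indicator {0<..} t
      \<le> ennreal K * indicator {0..1} t + ennreal (t powr (- a)) * indicator {1..} t"
      using bnd[of t] by (auto simp: indicator_def intro!: ennreal_leI add_increasing2)
  qed
  also have "\<dots> = ennreal K + ennreal (- (1 powr (- a + 1)) / (- a + 1))"
    by (subst nn_integral_add) (auto simp: int nn_integral_cmult)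
  also have "\<dots> < \<infinity>" by simp
  finally show ?thesis .
qed

section \<open>Coercivity of a positive definite quadratic form\<close>

text \<open>The form is continuous and positive on the compact unit sphere, so it has a positive
  lower bound there. Homogeneity of degree 2 extends the bound to all vectors.\<close>

lemma pos_def_coercive:
  assumes "U \<in> pos_def m"
  shows "\<exists>c>0. \<forall>v::nat \<Rightarrow> real. c * (\<Sum>i<m. (v i)\<^sup>2) \<le> (\<Sum>i<m. \<Sum>j<m. v i * v j * U $$ (i, j))"
proof -
  define Q where "Q v = (\<Sum>i<m. \<Sum>j<m. v i * v j * U $$ (i, j))" for v :: "nat \<Rightarrow> real"
  \<comment> \<open>Vectors are functions on all naturals with the coordinates from \<open>m\<close>
    on pinned to 0. This makes the cube \<open>C\<close> compact by Tychonoff, and the sphere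
    \<open>S\<close> is a closed part of it.\<close>
  define C :: "(nat \<Rightarrow> real) set" where "C = PiE UNIV (\<lambda>i. if i < m then {-1..1} else {0})"
  define S where "S = C \<inter> {v. (\<Sum>i<m. (v i)\<^sup>2) = 1}"
  have cont [continuous_intros]: "continuous_on A (\<lambda>v::nat \<Rightarrow> real. v i)" for A i
    by (rule continuous_on_subset[OF continuous_on_product_coordinates]) simp
  have "compactin (product_topology (\<lambda>i. euclidean) UNIV) C"
    unfolding C_def by (subst compactin_PiE) auto
  then have "compact C" by (simp add: euclidean_product_topology)
  moreover have "closed {v::nat \<Rightarrow> real. (\<Sum>i<m. (v i)\<^sup>2) = 1}"
    by (intro closed_Collect_eq continuous_intros)
  ultimately have "compact S" unfolding S_def by (rule compact_Int_closed)
  have pos: "0 < Q v" if "v i \<noteq> 0" "i < m" for v i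
  proof -
    let ?w = "vec m v"
    have "?w \<noteq> 0\<^sub>v m"
      using that by (metis index_vec index_zero_vec(1))
    then have "0 < ?w \<bullet> (U *\<^sub>v ?w)" using assms by (auto simp: pos_def_def)
    also have "?w \<bullet> (U *\<^sub>v ?w) = Q v"
      using assms by (auto simp: pos_def_def Q_def scalar_prod_def atLeast0LessThan sum_distrib_left
          intro!: sum.cong)
    finally show ?thesis .
  qed
  have "\<exists>c>0. \<forall>v\<in>S. c \<le> Q v"
  proof (cases "S = {}")
    \<comment> \<open>The sphere is empty only for \<open>m = 0\<close>, and then any positive
      constant serves.\<close>
    case True
    then show ?thesis by (intro exI[of _ 1]) auto
  next
    case False
    have "continuous_on S Q" unfolding Q_def by (intro continuous_intros)
    then obtain v where v: "v \<in> S" "\<forall>w\<in>S. Q v \<le> Q w"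
      using continuous_attains_inf[OF \<open>compact S\<close> False] by blast
    have "\<exists>i<m. v i \<noteq> 0"
    proof (rule ccontr)
      assume "\<not> (\<exists>i<m. v i \<noteq> 0)"
      then have "(\<Sum>i<m. (v i)\<^sup>2) = 0" by simp
      with v(1) show False by (simp add: S_def)
    qed
    with pos v(2) show ?thesis by blast
  qed
  then obtain c where c: "c > 0" "\<And>v. v \<in> S \<Longrightarrow> c \<le> Q v" by blast
  have "c * (\<Sum>i<m. (v i)\<^sup>2) \<le> Q v" for v
  proof (cases "\<exists>i<m. v i \<noteq> 0")
    case False
    then show ?thesis by (simp add: Q_def)
  next
    case True
    define q where "q = (\<Sum>i<m. (v i)\<^sup>2)"
    have le: "(v i)\<^sup>2 \<le> q" if "i < m" for i
      unfolding q_def using that by (intro member_le_sum) auto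
    have q: "0 < q"
      using True le by (metis less_le_trans zero_less_power2)
    \<comment> \<open>The normalised vector, cut off at \<open>m\<close> so that it lies in
      \<open>C\<close>; its coordinates are at most 1 in absolute value because each square is at
      most \<open>q\<close>.\<close>
    define w where "w i = (if i < m then v i / sqrt q else 0)" for i
    have w1: "\<bar>w i\<bar> \<le> 1" for i
      using le[of i] q by (auto simp: w_def real_le_rsqrt abs_le_square_iff[symmetric] intro!: real_le_rsqrt)
    have w0: "w i = 0" if "\<not> i < m" for i using that by (simp add: w_def)
    have "w \<in> C"
      unfolding C_def using w0 w1 by (auto simp: abs_le_iff minus_le_iff)
    moreover have "(\<Sum>i<m. (w i)\<^sup>2) = 1"
    proof -
      have "(\<Sum>i<m. (w i)\<^sup>2) = (\<Sum>i<m. (v i)\<^sup>2 / q)"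
        using q by (intro sum.cong) (auto simp: w_def power_divide)
      also have "\<dots> = 1" using q by (simp flip: sum_divide_distrib q_def)
      finally show ?thesis .
    qed
    ultimately have "c \<le> Q w" by (intro c) (simp add: S_def)
    also have "Q w = (\<Sum>i<m. \<Sum>j<m. v i * v j * U $$ (i, j) / q)"
      unfolding Q_def using q by (intro sum.cong) (auto simp: w_def)
    also have "\<dots> = Q v / q" by (simp add: Q_def sum_divide_distrib)
    finally show ?thesis using q by (simp add: q_def field_simps)
  qed
  with c(1) show ?thesis unfolding Q_def by blast
qed


section \<open>The inverse of a unit lower-triangular matrix\<close>

text \<open>Forward substitution for the inverse of \<open>mat_L m E x\<close>.\<close>

fun inv_entry :: "(nat \<times> nat) set \<Rightarrow> (nat \<times> nat \<Rightarrow> real) \<Rightarrow> nat \<Rightarrow> nat \<Rightarrow> real" where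
  "inv_entry E x i k = (if i = k then 1 else
     - (\<Sum>j<i. (if (i, j) \<in> free_entries E then x (i, j) else 0) * inv_entry E x j k))"

declare inv_entry.simps [simp del]

text \<open>What remains of the forward substitution at position \<open>e = (i, k)\<close> once the
  term \<open>x (i, k)\<close> is split off: the indices strictly between \<open>k\<close> and
  \<open>i\<close>. It plays the role of the shift \<open>g\<close> in
  \<open>nn_integral_triangular_shift\<close>.\<close>

definition drift :: "(nat \<times> nat) set \<Rightarrow> nat \<times> nat \<Rightarrow> (nat \<times> nat \<Rightarrow> real) \<Rightarrow> real" where
  "drift E e x = (\<Sum>j\<in>{snd e<..<fst e}.
     (if (fst e, j) \<in> free_entries E then x (fst e, j) else 0) * inv_entry E x j (snd e))"

lemma inv_entry_diag [simp]: "inv_entry E x i i = 1"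
  by (simp add: inv_entry.simps)

lemma inv_entry_upper: "i < k \<Longrightarrow> inv_entry E x i k = 0"
proof (induction i rule: less_induct)
  case (less i)
  then show ?case by (subst inv_entry.simps) (auto intro!: sum.neutral)
qed

text \<open>In the sum that defines the entry, the terms with \<open>j < k\<close> vanish because
  the inverse is lower triangular, the term \<open>j = k\<close> is \<open>x (i, k)\<close> times a
  diagonal entry 1, and the terms with \<open>j > k\<close> make up \<open>drift\<close>.\<close>

lemma inv_entry_free:
  assumes "(i, k) \<in> free_entries E"
  shows "inv_entry E x i k = - (x (i, k) + drift E (i, k) x)"
proof -
  have ki: "k < i" using assms by (simp add: free_entries_def)
  let ?t = "\<lambda>j. (if (i, j) \<in> free_entries E then x (i, j) else 0) * inv_entry E x j k"
  have split: "{..<i} = {..<k} \<union> insert k {k<..<i}" using ki by auto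
  have "sum ?t {..<i} = sum ?t {..<k} + sum ?t (insert k {k<..<i})"
    unfolding split by (rule sum.union_disjoint) auto
  also have "sum ?t {..<k} = 0" by (rule sum.neutral) (simp add: inv_entry_upper)
  also have "sum ?t (insert k {k<..<i}) = x (i, k) + drift E (i, k) x"
    unfolding drift_def fst_conv snd_conv using assms by simp
  finally show ?thesis using ki by (subst inv_entry.simps) simp
qed

lemma inv_entry_cong:
  assumes "\<And>a b. (a, b) \<in> free_entries E \<Longrightarrow> a \<le> i \<Longrightarrow> x (a, b) = y (a, b)"
  shows "inv_entry E x i k = inv_entry E y i k"
  using assms
proof (induction i rule: less_induct)
  case (less i)
  have "(\<Sum>j<i. (if (i, j) \<in> free_entries E then x (i, j) else 0) * inv_entry E x j k)
      = (\<Sum>j<i. (if (i, j) \<in> free_entries E then y (i, j) else 0) * inv_entry E y j k)"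
  proof (rule sum.cong[OF refl])
    fix j assume "j \<in> {..<i}"
    then have j: "j < i" by simp
    have "inv_entry E x j k = inv_entry E y j k"
    proof (rule less.IH[OF j])
      fix a b assume "(a, b) \<in> free_entries E" "a \<le> j"
      then show "x (a, b) = y (a, b)" using j by (intro less.prems) auto
    qed
    moreover have "(if (i, j) \<in> free_entries E then x (i, j) else 0) =
        (if (i, j) \<in> free_entries E then y (i, j) else 0)"
      using less.prems[of i j] by simp
    ultimately show "(if (i, j) \<in> free_entries E then x (i, j) else 0) * inv_entry E x j k =
        (if (i, j) \<in> free_entries E then y (i, j) else 0) * inv_entry E y j k"
      by (simp only:)
  qed
  then show ?case by (simp add: inv_entry.simps[of _ _ i])
qed

text \<open>The sum reads row \<open>i\<close> of the matrix only to the right of \<open>k\<close>,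
  and rows \<open>j < i\<close> of the inverse, which involve only rows of the matrix up to
  \<open>j\<close>. This is the triangular dependence that the substitution requires.\<close>

lemma drift_cong:
  assumes "\<And>a b. (a, b) \<in> free_entries E \<Longrightarrow> a < i \<or> a = i \<and> k < b \<Longrightarrow> x (a, b) = y (a, b)"
  shows "drift E (i, k) x = drift E (i, k) y"
  unfolding drift_def fst_conv snd_conv
proof (rule sum.cong[OF refl])
  fix j assume "j \<in> {k<..<i}"
  then have j: "j < i" "k < j" by auto
  have "inv_entry E x j k = inv_entry E y j k"
    by (rule inv_entry_cong, rule assms) (use j in auto)
  then show "(if (i, j) \<in> free_entries E then x (i, j) else 0) * inv_entry E x j k =
      (if (i, j) \<in> free_entries E then y (i, j) else 0) * inv_entry E y j k"
    using assms[of i j] j by simp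
qed

lemma measurable_inv_entry:
  "(\<lambda>x. inv_entry E x i k) \<in> borel_measurable (Pi\<^sub>M (free_entries E) (\<lambda>_. lborel))"
proof (induction i rule: less_induct)
  case (less i)
  have "(\<lambda>x. if (i, j) \<in> free_entries E then x (i, j) else 0)
      \<in> borel_measurable (Pi\<^sub>M (free_entries E) (\<lambda>_. lborel :: real measure))" for j
    by (cases "(i, j) \<in> free_entries E") auto
  then show ?case
    by (subst inv_entry.simps, cases "i = k")
      (auto intro!: borel_measurable_uminus borel_measurable_sum borel_measurable_times less.IH)
qed

lemma measurable_drift:
  "drift E e \<in> borel_measurable (Pi\<^sub>M (free_entries E) (\<lambda>_. lborel))"
proof -
  have "(\<lambda>x. if (i, j) \<in> free_entries E then x (i, j) else 0)
      \<in> borel_measurable (Pi\<^sub>M (free_entries E) (\<lambda>_. lborel :: real measure))" for i j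
    by (cases "(i, j) \<in> free_entries E") auto
  then show ?thesis
    unfolding drift_def[abs_def]
    by (auto intro!: borel_measurable_sum borel_measurable_times measurable_inv_entry)
qed

section \<open>The trace as a weighted sum of quadratic forms\<close>

text \<open>A one-sided inverse of a square matrix is two-sided, so \<open>A\<close> is a unit and
  \<open>mat_inverse\<close> does return a matrix; associativity identifies it with
  \<open>B\<close>.\<close>

lemma inv_mat_eqI:
  assumes A: "A \<in> carrier_mat n n" and B: "B \<in> carrier_mat n n" and AB: "A * B = 1\<^sub>m n"
  shows "inv_mat A = B"
proof -
  have BA: "B * A = 1\<^sub>m n" by (rule mat_mult_left_right_inverse[OF A B AB])
  have "A \<in> Units (ring_mat TYPE(real) n ())"
    using A B AB BA by (auto simp: Units_def ring_mat_def)
  then obtain C where C: "mat_inverse A = Some C" using mat_inverse(1)[OF A] by fastforce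
  from mat_inverse(2)[OF A C] have CA: "C * A = 1\<^sub>m n" and C': "C \<in> carrier_mat n n" by auto
  have "C * A * B = C * (A * B)" by (rule assoc_mult_mat[OF C' A B])
  then have "C = B" using B C' by (simp add: CA AB)
  then show ?thesis by (simp add: inv_mat_def C)
qed

text \<open>With \<open>N\<close> the inverse of \<open>L\<close>, the inverse of the product is the
  transpose of \<open>N\<close> times the inverse of \<open>D\<close> times \<open>N\<close>. Hence
  the form of \<open>U\<close> is evaluated at each row of \<open>N\<close>, with weight
  \<open>1 / d i\<close>.\<close>

lemma trace_inverse_mult:
  assumes U: "U \<in> carrier_mat m m" and d: "\<And>i. i < m \<Longrightarrow> d i \<noteq> 0"
  shows "mat_trace (inv_mat (mat_L m E x * mat_diag m d * (mat_L m E x)\<^sup>T) * U) =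
    (\<Sum>i<m. (\<Sum>a<m. \<Sum>b<m. inv_entry E x i a * inv_entry E x i b * U $$ (a, b)) / d i)"
proof -
  define L where "L = mat_L m E x"
  define N where "N = mat m m (\<lambda>(i, j). inv_entry E x i j)"
  define D where "D = mat_diag m d"
  define W where "W = mat_diag m (\<lambda>i. 1 / d i)"
  have L [simp]: "L \<in> carrier_mat m m" and N [simp]: "N \<in> carrier_mat m m"
    and D [simp]: "D \<in> carrier_mat m m" and W [simp]: "W \<in> carrier_mat m m"
    by (auto simp: L_def N_def D_def W_def mat_L_def)
  have LN: "L * N = 1\<^sub>m m"
  proof (rule eq_matI)
    fix i k assume ik: "i < dim_row (1\<^sub>m m :: real mat)" "k < dim_col (1\<^sub>m m :: real mat)"
    then have i: "i < m" "k < m" by auto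
    let ?t = "\<lambda>j. (if i = j then 1 else if (i, j) \<in> free_entries E then x (i, j) else 0) * inv_entry E x j k"
    have "(L * N) $$ (i, k) = (\<Sum>j<m. ?t j)"
      using i by (auto simp: L_def N_def mat_L_def scalar_prod_def atLeast0LessThan intro!: sum.cong)
    \<comment> \<open>Row \<open>i\<close> of \<open>L\<close> ends at the diagonal. Splitting off
      \<open>j = i\<close> exposes the recursion of \<open>inv_entry\<close>, which makes the
      off-diagonal entries cancel.\<close>
    also have "\<dots> = (\<Sum>j<Suc i. ?t j)"
      using i by (intro sum.mono_neutral_right) (auto simp: free_entries_def)
    also have "\<dots> = inv_entry E x i k +
        (\<Sum>j<i. (if (i, j) \<in> free_entries E then x (i, j) else 0) * inv_entry E x j k)"
      by (simp add: add.commute)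
    also have "\<dots> = (if i = k then 1 else 0)"
    proof (cases "i = k")
      case True
      then show ?thesis by (auto intro!: sum.neutral simp: inv_entry_upper)
    next
      case False
      then show ?thesis by (simp add: inv_entry.simps[of E x i k])
    qed
    finally show "(L * N) $$ (i, k) = 1\<^sub>m m $$ (i, k)" using i by simp
  qed (auto simp: L_def N_def mat_L_def)
  have NL: "N * L = 1\<^sub>m m" by (rule mat_mult_left_right_inverse[OF L N LN])
  have LtNt: "L\<^sup>T * N\<^sup>T = 1\<^sub>m m" using transpose_mult[OF N L] NL by simp
  have DW: "D * W = 1\<^sub>m m"
    unfolding D_def W_def mat_diag_diag using d by (intro eq_matI) (auto simp: mat_diag_def)
  define B where "B = N\<^sup>T * (W * N)"
  have B [simp]: "B \<in> carrier_mat m m" 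
    unfolding B_def by (intro mult_carrier_mat[of _ m m] transpose_carrier_mat[THEN iffD2] N W)
  have LD: "L * D \<in> carrier_mat m m" and WN: "W * N \<in> carrier_mat m m"
    and Lt: "L\<^sup>T \<in> carrier_mat m m" and Nt: "N\<^sup>T \<in> carrier_mat m m"
    by (auto intro: mult_carrier_mat[OF L D] mult_carrier_mat[OF W N])
  have "L * D * L\<^sup>T * B = L * D * (L\<^sup>T * N\<^sup>T * (W * N))"
    unfolding B_def assoc_mult_mat[OF LD Lt mult_carrier_mat[OF Nt WN]] assoc_mult_mat[OF Lt Nt WN] ..
  also have "\<dots> = L * D * (W * N)" unfolding LtNt left_mult_one_mat[OF WN] ..
  also have "\<dots> = L * (D * W * N)"
    unfolding assoc_mult_mat[OF L D WN] assoc_mult_mat[OF D W N] ..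
  also have "\<dots> = 1\<^sub>m m" unfolding DW left_mult_one_mat[OF N] LN ..
  finally have inv: "inv_mat (L * D * L\<^sup>T) = B" by (rule inv_mat_eqI[OF mult_carrier_mat[OF LD Lt] B])
  have Bab: "B $$ (a, b) = (\<Sum>i<m. inv_entry E x i a * inv_entry E x i b / d i)"
    if "a < m" "b < m" for a b
    unfolding B_def W_def mat_diag_mult_left[OF N] using that
    by (auto simp: N_def scalar_prod_def atLeast0LessThan intro!: sum.cong)
  have "mat_trace (B * U) = (\<Sum>b<m. \<Sum>a<m. B $$ (b, a) * U $$ (a, b))"
    using carrier_matD[OF U] carrier_matD[OF B] by (auto simp: mat_trace_def scalar_prod_def atLeast0LessThan intro!: sum.cong)
  also have "\<dots> = (\<Sum>a<m. \<Sum>b<m. B $$ (b, a) * U $$ (a, b))"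
    by (rule sum.swap)
  also have "\<dots> = (\<Sum>a<m. \<Sum>b<m. \<Sum>i<m. inv_entry E x i a * inv_entry E x i b * U $$ (a, b) / d i)"
    by (intro sum.cong refl) (simp add: Bab sum_distrib_left sum_distrib_right mult_ac)
  also have "\<dots> = (\<Sum>a<m. \<Sum>i<m. \<Sum>b<m. inv_entry E x i a * inv_entry E x i b * U $$ (a, b) / d i)"
    by (rule sum.cong[OF refl], rule sum.swap)
  also have "\<dots> = (\<Sum>i<m. \<Sum>a<m. \<Sum>b<m. inv_entry E x i a * inv_entry E x i b * U $$ (a, b) / d i)"
    by (rule sum.swap)
  finally show ?thesis by (simp add: inv[unfolded L_def D_def] sum_divide_distrib)
qed

section \<open>Integration over the free entries of L\<close>

text \<open>\<open>i * m + (m - 1 - k)\<close> numbers the positions row by row, each row from right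
  to left; the column bounds keep the second digit below \<open>m\<close>.\<close>

lemma rank_less:
  fixes a b i k m :: nat
  assumes "b < m" "k < m" "a < i \<or> a = i \<and> k < b"
  shows "a * m + (m - 1 - b) < i * m + (m - 1 - k)"
proof (cases "a < i")
  case True
  then have "Suc a * m \<le> i * m" by (intro mult_right_mono) auto
  then show ?thesis using assms by simp
qed (use assms in auto)

text \<open>After the triangular substitution every position of row \<open>i\<close> contributes the
  same Gaussian integral, and row \<open>i\<close> has one position per earlier neighbour. The
  weights \<open>c i\<close> will be \<open>c / (2 * d i)\<close> for fixed
  \<open>d\<close>.\<close>

lemma nn_integral_free_entries:
  fixes c :: "nat \<Rightarrow> real"
  assumes G: "undirected_graph m E" and c: "\<And>i. i < m \<Longrightarrow> 0 < c i"
  shows "(\<integral>\<^sup>+ x. (\<Prod>e\<in>free_entries E. ennreal (exp (- c (fst e) * (x e + drift E e x)\<^sup>2)))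
      \<partial>Pi\<^sub>M (free_entries E) (\<lambda>_. lborel)) =
    (\<Prod>i<m. ennreal (sqrt (pi / c i) ^ card (pred_nbrs E i)))"
proof -
  let ?I = "free_entries E"
  define r :: "nat \<times> nat \<Rightarrow> nat" where "r e = fst e * m + (m - 1 - snd e)" for e
  have mem: "a < m \<and> b < m" if "(a, b) \<in> ?I" for a b
    using G that by (auto simp: undirected_graph_def free_entries_def)
  have I: "?I = Sigma {..<m} (pred_nbrs E)"
    using mem by (fastforce simp: free_entries_def pred_nbrs_def)
  have fin: "finite ?I"
    by (rule finite_subset[of _ "{..<m} \<times> {..<m}"]) (auto dest: mem)
  have less: "r (a, b) < r (i, k)" if "(a, b) \<in> ?I" "(i, k) \<in> ?I" "a < i \<or> a = i \<and> k < b" for a b i k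
    using that mem rank_less[of b m k a i] by (simp add: r_def)
  have inj: "inj_on r ?I"
  proof (rule inj_onI, clarify)
    fix a b i k assume e: "(a, b) \<in> ?I" "(i, k) \<in> ?I" "r (a, b) = r (i, k)"
    show "a = i \<and> b = k"
      using less[OF e(1,2)] less[OF e(2,1)] e(3) by (metis less_irrefl linorder_neqE_nat)
  qed
  have "(\<integral>\<^sup>+ x. (\<Prod>e\<in>?I. ennreal (exp (- c (fst e) * (x e + drift E e x)\<^sup>2))) \<partial>Pi\<^sub>M ?I (\<lambda>_. lborel))
      = (\<Prod>e\<in>?I. \<integral>\<^sup>+ t. ennreal (exp (- c (fst e) * t\<^sup>2)) \<partial>lborel)"
  proof (rule nn_integral_triangular_shift[where r = r])
    fix e and x y :: "nat \<times> nat \<Rightarrow> real"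
    assume e: "e \<in> ?I" and eq: "\<And>e'. e' \<in> ?I \<Longrightarrow> r e' < r e \<Longrightarrow> x e' = y e'"
    obtain i k where ik: "e = (i, k)" by (cases e)
    show "drift E e x = drift E e y"
      unfolding ik by (rule drift_cong, rule eq) (use e ik less in auto)
  qed (auto intro: fin inj measurable_drift)
  also have "\<dots> = (\<Prod>e\<in>?I. ennreal (sqrt (pi / c (fst e))))"
    by (intro prod.cong nn_integral_gaussian refl) (use c mem in auto)
  also have "\<dots> = (\<Prod>i<m. \<Prod>k\<in>pred_nbrs E i. ennreal (sqrt (pi / c i)))"
    unfolding I by (subst prod.Sigma) (auto simp: split_beta pred_nbrs_def)
  also have "\<dots> = (\<Prod>i<m. ennreal (sqrt (pi / c i) ^ card (pred_nbrs E i)))"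
    using c by (intro prod.cong) (auto simp: ennreal_power less_imp_le)
  finally show ?thesis .
qed

section \<open>Domination of the integrand by a product\<close>

text \<open>Coercivity is applied to each row of the inverse, and the squares outside the diagonal
  and the free positions are dropped. The exponent becomes a sum over positions and rows, so its
  exponential factorises.\<close>

lemma exponent_bound:
  fixes \<alpha> d :: "nat \<Rightarrow> real"
  assumes G: "undirected_graph m E" and U: "U \<in> carrier_mat m m"
    and c: "\<And>v::nat \<Rightarrow> real. c * (\<Sum>i<m. (v i)\<^sup>2) \<le> (\<Sum>i<m. \<Sum>j<m. v i * v j * U $$ (i, j))" "0 < c"
    and d: "\<And>i. i < m \<Longrightarrow> 0 < d i"
  shows "exp (- (1 / 2) * (mat_trace (inv_mat (mat_L m E x * mat_diag m d * (mat_L m E x)\<^sup>T) * U)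
        + (\<Sum>i<m. \<alpha> i * ln (mat_diag m d $$ (i, i)))))
    \<le> (\<Prod>e\<in>free_entries E. exp (- (c / (2 * d (fst e))) * (x e + drift E e x)\<^sup>2)) *
       (\<Prod>i<m. exp (- (c / 2 / d i)) * d i powr (- (\<alpha> i / 2)))"
proof -
  let ?q = "\<lambda>i. \<Sum>a<m. \<Sum>b<m. inv_entry E x i a * inv_entry E x i b * U $$ (a, b)"
  let ?z = "\<lambda>e. (x e + drift E e x)\<^sup>2"
  have I: "free_entries E = Sigma {..<m} (pred_nbrs E)"
    using G by (auto simp: free_entries_def pred_nbrs_def undirected_graph_def)
  have fin: "finite (pred_nbrs E i)" for i by (simp add: pred_nbrs_def)
  have q: "c * (1 + (\<Sum>k\<in>pred_nbrs E i. ?z (i, k))) \<le> ?q i" if i: "i < m" for i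
  proof -
    have "(\<Sum>k\<in>pred_nbrs E i. ?z (i, k)) = (\<Sum>k\<in>pred_nbrs E i. (inv_entry E x i k)\<^sup>2)"
    proof (rule sum.cong[OF refl])
      fix k assume "k \<in> pred_nbrs E i"
      then have "inv_entry E x i k = - (x (i, k) + drift E (i, k) x)"
        by (intro inv_entry_free) (simp add: free_entries_def pred_nbrs_def)
      then show "?z (i, k) = (inv_entry E x i k)\<^sup>2" by (simp only: power2_minus)
    qed
    then have "1 + (\<Sum>k\<in>pred_nbrs E i. ?z (i, k)) = 1 + (\<Sum>k\<in>pred_nbrs E i. (inv_entry E x i k)\<^sup>2)"
      by (simp only:)
    \<comment> \<open>The summand 1 is the square of the diagonal entry, and \<open>i\<close> is not
      one of its own earlier neighbours.\<close>
    also have "\<dots> = (\<Sum>k\<in>insert i (pred_nbrs E i). (inv_entry E x i k)\<^sup>2)"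
      using fin by (subst sum.insert) (auto simp: pred_nbrs_def)
    also have "\<dots> \<le> (\<Sum>k<m. (inv_entry E x i k)\<^sup>2)"
      using i by (intro sum_mono2) (auto simp: pred_nbrs_def)
    finally have "c * (1 + (\<Sum>k\<in>pred_nbrs E i. ?z (i, k))) \<le> c * (\<Sum>k<m. (inv_entry E x i k)\<^sup>2)"
      using c(2) by simp
    also have "\<dots> \<le> ?q i" by (rule c(1))
    finally show ?thesis .
  qed
  have tr: "mat_trace (inv_mat (mat_L m E x * mat_diag m d * (mat_L m E x)\<^sup>T) * U) = (\<Sum>i<m. ?q i / d i)"
    using d by (intro trace_inverse_mult[OF U]) fastforce
  have diag: "(\<Sum>i<m. \<alpha> i * ln (mat_diag m d $$ (i, i))) = (\<Sum>i<m. \<alpha> i * ln (d i))"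
    by (auto simp: mat_diag_def)
  have "(\<Sum>i<m. c * (1 + (\<Sum>k\<in>pred_nbrs E i. ?z (i, k))) / d i) \<le> (\<Sum>i<m. ?q i / d i)"
    using d q by (intro sum_mono divide_right_mono) (auto simp: less_imp_le)
  then have "exp (- (1 / 2) * ((\<Sum>i<m. ?q i / d i) + (\<Sum>i<m. \<alpha> i * ln (d i))))
      \<le> exp (- (1 / 2) * ((\<Sum>i<m. c * (1 + (\<Sum>k\<in>pred_nbrs E i. ?z (i, k))) / d i) + (\<Sum>i<m. \<alpha> i * ln (d i))))"
    by simp
  also have "- (1 / 2) * ((\<Sum>i<m. c * (1 + (\<Sum>k\<in>pred_nbrs E i. ?z (i, k))) / d i) + (\<Sum>i<m. \<alpha> i * ln (d i)))
      = (\<Sum>i<m. (\<Sum>k\<in>pred_nbrs E i. - (c / (2 * d i)) * ?z (i, k)) + (- (c / 2 / d i) + - (\<alpha> i / 2) * ln (d i)))"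
    unfolding sum.distrib[symmetric] sum_distrib_left
    by (intro sum.cong refl, subst sum_distrib_left[symmetric])
      (simp add: algebra_simps add_divide_distrib)
  also have "exp \<dots> = (\<Prod>i<m. (\<Prod>k\<in>pred_nbrs E i. exp (- (c / (2 * d i)) * ?z (i, k))) *
      (exp (- (c / 2 / d i)) * exp (- (\<alpha> i / 2) * ln (d i))))"
    using fin by (simp only: exp_sum[OF finite_lessThan] exp_add exp_sum[OF fin])
  also have "\<dots> = (\<Prod>i<m. \<Prod>k\<in>pred_nbrs E i. exp (- (c / (2 * d i)) * ?z (i, k))) *
      (\<Prod>i<m. exp (- (c / 2 / d i)) * exp (- (\<alpha> i / 2) * ln (d i)))"
    by (rule prod.distrib)
  also have "(\<Prod>i<m. \<Prod>k\<in>pred_nbrs E i. exp (- (c / (2 * d i)) * ?z (i, k))) =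
      (\<Prod>e\<in>free_entries E. exp (- (c / (2 * d (fst e))) * ?z e))"
    unfolding I by (subst prod.Sigma) (auto simp: split_beta fin)
  also have "(\<Prod>i<m. exp (- (c / 2 / d i)) * exp (- (\<alpha> i / 2) * ln (d i))) =
      (\<Prod>i<m. exp (- (c / 2 / d i)) * d i powr (- (\<alpha> i / 2)))"
    using d by (intro prod.cong) (force simp: powr_def)+
  finally show ?thesis unfolding tr diag .
qed

section \<open>Integration over the diagonal of D, and conclusion\<close>

lemma prod_ennreal_less_top:
  fixes f :: "'a \<Rightarrow> ennreal"
  assumes "\<And>i. i \<in> A \<Longrightarrow> f i < \<infinity>"
  shows "prod f A < \<infinity>"
  using assms by (induction A rule: infinite_finite_induct) (auto simp: ennreal_mult_less_top)

text \<open>The \<open>n\<close> Gaussian integrals of a row contribute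
  \<open>t powr (real n / 2)\<close> up to a constant. The remaining power of \<open>t\<close> is
  \<open>- ((a - real n) / 2)\<close>, and the assumption on \<open>a\<close> says that
  \<open>(a - real n) / 2 > 1\<close>.\<close>

lemma diagonal_entry_integral_finite:
  fixes a c :: real
  assumes "real n + 2 < a" "0 < c"
  shows "(\<integral>\<^sup>+ t. ennreal (sqrt (pi / (c / (2 * t))) ^ n) *
    (ennreal (exp (- (c / 2 / t)) * t powr (- (a / 2))) * indicator {0<..} t) \<partial>lborel) < \<infinity>"
proof -
  define K where "K = sqrt (2 * pi / c) ^ n"
  have K: "0 \<le> K" using assms by (simp add: K_def)
  have eq: "ennreal (sqrt (pi / (c / (2 * t))) ^ n) *
      (ennreal (exp (- (c / 2 / t)) * t powr (- (a / 2))) * indicator {0<..} t) =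
    ennreal K * (ennreal (t powr (- ((a - real n) / 2)) * exp (- (c / 2 / t))) * indicator {0<..} t)" for t
  proof (cases "0 < t")
    case True
    have "sqrt (pi / (c / (2 * t))) ^ n = K * sqrt t ^ n"
      by (simp add: K_def real_sqrt_mult real_sqrt_divide mult_ac flip: power_mult_distrib)
    also have "sqrt t ^ n = t powr (real n / 2)"
      using True by (simp add: powr_half_sqrt[symmetric] powr_power)
    finally have "sqrt (pi / (c / (2 * t))) ^ n * (exp (- (c / 2 / t)) * t powr (- (a / 2)))
        = K * ((t powr (real n / 2) * t powr (- (a / 2))) * exp (- (c / 2 / t)))"
      by (simp add: mult_ac)
    also have "t powr (real n / 2) * t powr (- (a / 2)) = t powr (- ((a - real n) / 2))"
      by (simp add: diff_divide_distrib flip: powr_add)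
    finally show ?thesis
      using True K assms by (simp add: ennreal_mult[symmetric])
  qed simp
  have "(\<integral>\<^sup>+ t. ennreal (t powr (- ((a - real n) / 2)) * exp (- (c / 2 / t))) * indicator {0<..} t \<partial>lborel) < \<infinity>"
    using assms by (intro nn_integral_powr_exp_inverse_finite) auto
  then show ?thesis
    unfolding eq by (subst nn_integral_cmult) (auto simp: ennreal_mult_less_top)
qed

theorem theorem1:
  fixes m :: nat and E :: "(nat \<times> nat) set" and U :: "real mat" and \<alpha> :: "nat \<Rightarrow> real"
  assumes "undirected_graph m E"
    and "decomposable m E"
    and "order_in_S_D m E"
    and "U \<in> pos_def m"
    and "\<forall>i<m. 0 \<le> \<alpha> i"
    and "\<forall>i<m. \<alpha> i > real (card (pred_nbrs E i)) + 2"
  shows "nn_integral_Theta_G m E (\<lambda>L D.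
           ennreal (exp (- (1 / 2) * (mat_trace (inv_mat (L * D * L\<^sup>T) * U)
                                      + (\<Sum>i<m. \<alpha> i * ln (D $$ (i, i))))))) < \<infinity>"
proof -
  obtain c where c: "0 < c"
    "\<And>v::nat \<Rightarrow> real. c * (\<Sum>i<m. (v i)\<^sup>2) \<le> (\<Sum>i<m. \<Sum>j<m. v i * v j * U $$ (i, j))"
    using pos_def_coercive[OF assms(4)] by blast
  have U: "U \<in> carrier_mat m m" using assms(4) by (simp add: pos_def_def)
  let ?I = "free_entries E"
  let ?M = "Pi\<^sub>M ?I (\<lambda>_. lborel) :: (nat \<times> nat \<Rightarrow> real) measure"
  let ?N = "Pi\<^sub>M {..<m} (\<lambda>_. lborel) :: (nat \<Rightarrow> real) measure"
  define g where "g d x = (\<Prod>e\<in>?I. ennreal (exp (- (c / (2 * d (fst e))) * (x e + drift E e x)\<^sup>2)))"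
    for d :: "nat \<Rightarrow> real" and x
  \<comment> \<open>The indicator puts the constraint \<open>D > 0\<close> into the factors, so that
    the bound remains a product over coordinates on the whole space.\<close>
  define h where "h i t = ennreal (exp (- (c / 2 / t)) * t powr (- (\<alpha> i / 2))) * indicator {0<..} t"
    for i and t :: real
  have h_meas [measurable]: "h i \<in> borel_measurable borel" for i
    unfolding h_def[abs_def] by measurable
  have IE: "fst e < m" if "e \<in> ?I" for e
    using assms(1) that by (auto simp: undirected_graph_def free_entries_def)
  have "finite ?I"
    using assms(1) by (intro finite_subset[of ?I "{..<m} \<times> {..<m}"]) (auto simp: undirected_graph_def free_entries_def)
  then interpret M: finite_product_sigma_finite "\<lambda>_. lborel :: real measure" ?I
    by unfold_locales
  interpret N: finite_product_sigma_finite "\<lambda>_. lborel :: real measure" "{..<m}"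
    by unfold_locales simp
  interpret MN: pair_sigma_finite ?M ?N
    by unfold_locales
  have g_pair: "(\<lambda>(x, d). g d x) \<in> borel_measurable (?M \<Otimes>\<^sub>M ?N)"
    unfolding g_def split_beta
  proof (rule borel_measurable_prod_ennreal)
    fix e assume e: "e \<in> ?I"
    have "fst e \<in> {..<m}" using IE[OF e] by simp
    then have [measurable]: "(\<lambda>p. snd p (fst e)) \<in> borel_measurable (?M \<Otimes>\<^sub>M ?N)"
      by measurable
    have [measurable]: "(\<lambda>p. fst p e) \<in> borel_measurable (?M \<Otimes>\<^sub>M ?N)"
      using e by measurable
    note measurable_drift[measurable]
    show "(\<lambda>p. ennreal (exp (- (c / (2 * snd p (fst e))) * (fst p e + drift E e (fst p))\<^sup>2)))
        \<in> borel_measurable (?M \<Otimes>\<^sub>M ?N)"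
      by measurable
  qed
  have h_pair: "(\<lambda>d. \<Prod>i<m. h i (d i)) \<in> borel_measurable ?N"
    by measurable
  have meas: "(\<lambda>(x, d). g d x * (\<Prod>i<m. h i (d i))) \<in> borel_measurable (?M \<Otimes>\<^sub>M ?N)"
    using g_pair measurable_compose[OF measurable_snd h_pair]
    unfolding split_beta by (rule borel_measurable_times_ennreal)
  have inner: "(\<integral>\<^sup>+ x. g d x * (\<Prod>i<m. h i (d i)) \<partial>?M) =
      (\<Prod>i<m. ennreal (sqrt (pi / (c / (2 * d i))) ^ card (pred_nbrs E i)) * h i (d i))"
    if d: "d \<in> space ?N" for d
  \<comment> \<open>The Gaussian formula requires all \<open>d i\<close> to be positive. Otherwise
    some factor \<open>h i (d i)\<close> is 0 and both sides vanish.\<close>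
  proof (cases "\<forall>i<m. 0 < d i")
    case True
    have "(\<lambda>x. g d x) \<in> borel_measurable ?M"
      using measurable_Pair1[OF g_pair d] by simp
    then have "(\<integral>\<^sup>+ x. g d x * (\<Prod>i<m. h i (d i)) \<partial>?M) = (\<integral>\<^sup>+ x. g d x \<partial>?M) * (\<Prod>i<m. h i (d i))"
      by (rule nn_integral_multc)
    also have "(\<integral>\<^sup>+ x. g d x \<partial>?M) = (\<Prod>i<m. ennreal (sqrt (pi / (c / (2 * d i))) ^ card (pred_nbrs E i)))"
      unfolding g_def using True c(1) by (intro nn_integral_free_entries[OF assms(1)]) auto
    finally show ?thesis by (simp add: prod.distrib)
  next
    case False
    then obtain i where i: "i < m" "h i (d i) = 0" by (auto simp: h_def)
    then have "(\<Prod>i<m. h i (d i)) = 0" by (auto intro!: prod_zero)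
    moreover from i
    have "(\<Prod>i<m. ennreal (sqrt (pi / (c / (2 * d i))) ^ card (pred_nbrs E i)) * h i (d i)) = 0"
      by (auto intro!: prod_zero)
    ultimately show ?thesis by (simp only: mult_zero_right nn_integral_const mult_zero_left)
  qed
  have "nn_integral_Theta_G m E (\<lambda>L D.
      ennreal (exp (- (1 / 2) * (mat_trace (inv_mat (L * D * L\<^sup>T) * U)
                                 + (\<Sum>i<m. \<alpha> i * ln (D $$ (i, i)))))))
    \<le> (\<integral>\<^sup>+ (x, d). g d x * (\<Prod>i<m. h i (d i)) \<partial>(?M \<Otimes>\<^sub>M ?N))"
    unfolding nn_integral_Theta_G_def
  proof (rule nn_integral_mono, clarify)
    fix x d
    let ?f = "exp (- (1 / 2) * (mat_trace (inv_mat (mat_L m E x * mat_diag m d * (mat_L m E x)\<^sup>T) * U)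
        + (\<Sum>i<m. \<alpha> i * ln (mat_diag m d $$ (i, i)))))"
    show "ennreal ?f * indicator (Theta_G m E) (mat_L m E x, mat_diag m d) \<le> g d x * (\<Prod>i<m. h i (d i))"
    proof (cases "(mat_L m E x, mat_diag m d) \<in> Theta_G m E")
      case True
      then have d: "\<And>i. i < m \<Longrightarrow> 0 < d i"
        by (auto simp: Theta_G_def pos_diagonal_def mat_diag_def)
      have "ennreal ?f \<le> ennreal ((\<Prod>e\<in>?I. exp (- (c / (2 * d (fst e))) * (x e + drift E e x)\<^sup>2)) *
          (\<Prod>i<m. exp (- (c / 2 / d i)) * d i powr (- (\<alpha> i / 2))))"
        by (intro ennreal_leI exponent_bound assms(1) U c d)
      also have "\<dots> = g d x * (\<Prod>i<m. ennreal (exp (- (c / 2 / d i)) * d i powr (- (\<alpha> i / 2))))"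
        unfolding g_def by (subst (1 2) prod_ennreal) (auto intro!: ennreal_mult prod_nonneg)
      also have "(\<Prod>i<m. ennreal (exp (- (c / 2 / d i)) * d i powr (- (\<alpha> i / 2)))) = (\<Prod>i<m. h i (d i))"
        using d by (intro prod.cong) (auto simp: h_def)
      finally show ?thesis using True by simp
    qed simp
  qed
  \<comment> \<open>Tonelli: the entries of \<open>L\<close> are integrated first, since the
    Gaussian widths depend on \<open>d\<close>.\<close>
  also have "\<dots> = (\<integral>\<^sup>+ d. \<integral>\<^sup>+ x. g d x * (\<Prod>i<m. h i (d i)) \<partial>?M \<partial>?N)"
    using MN.nn_integral_snd[OF meas] by simp
  also have "\<dots> = (\<integral>\<^sup>+ d. (\<Prod>i<m. ennreal (sqrt (pi / (c / (2 * d i))) ^ card (pred_nbrs E i)) * h i (d i)) \<partial>?N)"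
    by (intro nn_integral_cong inner)
  \<comment> \<open>Each factor now depends on one coordinate of \<open>d\<close> only, so the
    integral splits into one-dimensional ones.\<close>
  also have "\<dots> = (\<Prod>i<m. \<integral>\<^sup>+ t. ennreal (sqrt (pi / (c / (2 * t))) ^ card (pred_nbrs E i)) * h i t \<partial>lborel)"
    by (rule lborel_product.product_nn_integral_prod) auto
  also have "\<dots> < \<infinity>"
    unfolding h_def
    by (intro prod_ennreal_less_top diagonal_entry_integral_finite) (use assms(6) c(1) in auto)
  finally show ?thesis .
qed

end
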